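(* Let $(M^{2n},J)$ be a compact almost complex manifold of real dimension $2n$ and assume that $J$ admits tamed symplectic forms. The following are equivalent: (i) $J$ admits a compatible symplectic form; (ii) for any $\alpha\in\Omega_J^-$, if there exists a $J$-tamed symplectic form whose $J$-anti-invariant part is $\alpha$, then there also exists a $J$-tamed symplectic form whose $J$-anti-invariant part is $-\alpha$.
   Context: Manifolds are smooth and without boundary, and $J$ is a smooth almost complex structure (not assumed integrable). $\Omega^2$ is the space of real $C^\infty$ $2$-forms on $M$. $J$ acts on $\Omega^2$ as the involution $\alpha(\cdot,\cdot)\mapsto \alpha(J\cdot,J\cdot)$, which gives the splitting $\Omega^2=\Omega_J^+\oplus\Omega_J^-$ into $J$-invariant forms ($\alpha(J\cdot,J\cdot)=\alpha$) and $J$-anti-invariant forms ($\alpha(J\cdot,J\cdot)=-\alpha$). The $J$-anti-invariant part of a $2$-form is its component in $\Omega_J^-$ under this splitting. A symplectic form is a closed nondegenerate $2$-form. A symplectic form $\omega$ is $J$-tamed (it tames $J$) if it is $J$-positive: $\omega(X,JX)>0$ for all nonzero $X\in TM$. A symplectic form $\omega$ is $J$-compatible (compatible with $J$) if it is $J$-positive and $J$-invariant, i.e. also $\omega(JY,JZ)=\omega(Y,Z)$ for all tangent vectors $Y,Z$ at the same point. *)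

theory Defs
  imports "HOL-Analysis.Analysis"
begin

section \<open>Smooth maps on open sets of Euclidean space\<close>

text \<open>\<open>S\<close> is meant to be open, so that derivatives at points of \<open>S\<close> only see \<open>f\<close> on \<open>S\<close>.\<close>

primrec Ck_on :: "nat \<Rightarrow> 'e::euclidean_space set \<Rightarrow> ('e \<Rightarrow> 'f::real_normed_vector) \<Rightarrow> bool" where
  "Ck_on 0 S f \<longleftrightarrow> continuous_on S f"
| "Ck_on (Suc k) S f \<longleftrightarrow>
     (\<forall>x\<in>S. f differentiable (at x)) \<and>
     (\<forall>v. Ck_on k S (\<lambda>x. frechet_derivative f (at x) v))"

definition smooth_on :: "'e::euclidean_space set \<Rightarrow> ('e \<Rightarrow> 'f::real_normed_vector) \<Rightarrow> bool" where
  "smooth_on S f \<longleftrightarrow> (\<forall>k. Ck_on k S f)"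

section \<open>Smooth manifolds and tangent spaces\<close>

text \<open>A chart is a domain together with a coordinate map into the model space \<open>'e\<close>; the
  values of the coordinate map outside the domain are irrelevant.\<close>

type_synonym ('a, 'e) chart = "'a set \<times> ('a \<Rightarrow> 'e)"

abbreviation chart_dom :: "('a, 'e) chart \<Rightarrow> 'a set" where
  "chart_dom c \<equiv> fst c"

abbreviation chart_map :: "('a, 'e) chart \<Rightarrow> 'a \<Rightarrow> 'e" where
  "chart_map c \<equiv> snd c"

definition chart_img :: "('a, 'e) chart \<Rightarrow> 'e set" where
  "chart_img c = chart_map c ` chart_dom c"

definition chart_inv :: "('a, 'e) chart \<Rightarrow> 'e \<Rightarrow> 'a" where
  "chart_inv c = inv_into (chart_dom c) (chart_map c)"

definition is_chart :: "'a topology \<Rightarrow> ('a, 'e::euclidean_space) chart \<Rightarrow> bool" where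
  "is_chart M c \<longleftrightarrow>
     openin M (chart_dom c) \<and> open (chart_img c) \<and>
     homeomorphic_map (subtopology M (chart_dom c)) (top_of_set (chart_img c)) (chart_map c)"

definition smooth_atlas :: "'a topology \<Rightarrow> ('a, 'e::euclidean_space) chart set \<Rightarrow> bool" where
  "smooth_atlas M A \<longleftrightarrow>
     (\<forall>c\<in>A. is_chart M c) \<and>
     (\<Union>c\<in>A. chart_dom c) = topspace M \<and>
     (\<forall>c\<in>A. \<forall>d\<in>A.
        smooth_on (chart_map c ` (chart_dom c \<inter> chart_dom d)) (chart_map d \<circ> chart_inv c))"

definition smooth_manifold :: "'a topology \<Rightarrow> ('a, 'e::euclidean_space) chart set \<Rightarrow> bool" where
  "smooth_manifold M A \<longleftrightarrow> Hausdorff_space M \<and> second_countable M \<and> smooth_atlas M A"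

text \<open>A tangent vector at \<open>p\<close> is the family of its components in all charts of the atlas around
  \<open>p\<close>, related by the derivatives of the coordinate changes; the components in the remaining
  charts are set to \<open>0\<close>. Vector space operations are componentwise.\<close>

type_synonym ('a, 'e) tvec = "('a, 'e) chart \<Rightarrow> 'e"

definition tangent_space ::
    "('a, 'e::euclidean_space) chart set \<Rightarrow> 'a \<Rightarrow> ('a, 'e) tvec set" where
  "tangent_space A p = {X.
     (\<forall>c. c \<notin> A \<or> p \<notin> chart_dom c \<longrightarrow> X c = 0) \<and>
     (\<forall>c\<in>A. \<forall>d\<in>A. p \<in> chart_dom c \<longrightarrow> p \<in> chart_dom d \<longrightarrow>
        X d = frechet_derivative (chart_map d \<circ> chart_inv c) (at (chart_map c p)) (X c))}"

definition tv_zero :: "('a, 'e::euclidean_space) tvec" where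
  "tv_zero = (\<lambda>c. 0)"

definition tv_lincomb ::
    "real \<Rightarrow> ('a, 'e::euclidean_space) tvec \<Rightarrow> real \<Rightarrow> ('a, 'e) tvec \<Rightarrow> ('a, 'e) tvec" where
  "tv_lincomb a X b Y = (\<lambda>c. a *\<^sub>R X c + b *\<^sub>R Y c)"

text \<open>The tangent vector at \<open>p\<close> whose component in the chart \<open>c\<close> is \<open>u\<close>; for fixed \<open>u\<close> and
  varying \<open>p\<close> this is the constant coordinate vector field \<open>u\<close> of \<open>c\<close>.\<close>

definition coord_vec ::
    "('a, 'e::euclidean_space) chart set \<Rightarrow> ('a, 'e) chart \<Rightarrow> 'a \<Rightarrow> 'e \<Rightarrow> ('a, 'e) tvec" where
  "coord_vec A c p u = (\<lambda>d. if d \<in> A \<and> p \<in> chart_dom d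
     then frechet_derivative (chart_map d \<circ> chart_inv c) (at (chart_map c p)) u else 0)"

section \<open>Differential 2-forms\<close>

type_synonym ('a, 'e) form2 = "'a \<Rightarrow> ('a, 'e) tvec \<Rightarrow> ('a, 'e) tvec \<Rightarrow> real"

definition form2_rep ::
    "('a, 'e::euclidean_space) chart set \<Rightarrow> ('a, 'e) chart \<Rightarrow> ('a, 'e) form2 \<Rightarrow>
     'e \<Rightarrow> 'e \<Rightarrow> 'e \<Rightarrow> real" where
  "form2_rep A c \<omega> x u v =
     (let p = chart_inv c x in \<omega> p (coord_vec A c p u) (coord_vec A c p v))"

text \<open>Forms are normalised to be \<open>0\<close> on arguments that are not tangent vectors at a point of
  the manifold, so that equality of forms is equality of functions.\<close>

definition forms2 ::
    "'a topology \<Rightarrow> ('a, 'e::euclidean_space) chart set \<Rightarrow> ('a, 'e) form2 set" where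
  "forms2 M A = {\<omega>.
     (\<forall>p X Y. \<not> (p \<in> topspace M \<and> X \<in> tangent_space A p \<and> Y \<in> tangent_space A p) \<longrightarrow>
        \<omega> p X Y = 0) \<and>
     (\<forall>p\<in>topspace M. \<forall>X\<in>tangent_space A p. \<forall>Y\<in>tangent_space A p.
        \<omega> p Y X = - \<omega> p X Y) \<and>
     (\<forall>p\<in>topspace M. \<forall>X\<in>tangent_space A p. \<forall>Y\<in>tangent_space A p. \<forall>Z\<in>tangent_space A p.
        \<forall>a b. \<omega> p (tv_lincomb a X b Y) Z = a * \<omega> p X Z + b * \<omega> p Y Z) \<and>
     (\<forall>c\<in>A. \<forall>u v. smooth_on (chart_img c) (\<lambda>x. form2_rep A c \<omega> x u v))}"

text \<open>The exterior derivative of a 2-form on Euclidean space, evaluated on constant vector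
  fields (whose brackets vanish, so only the derivative terms of the invariant formula
  remain).\<close>

definition ext_deriv2 ::
    "('e::euclidean_space \<Rightarrow> 'e \<Rightarrow> 'e \<Rightarrow> real) \<Rightarrow> 'e \<Rightarrow> 'e \<Rightarrow> 'e \<Rightarrow> 'e \<Rightarrow> real" where
  "ext_deriv2 \<beta> x u v w =
     frechet_derivative (\<lambda>y. \<beta> y v w) (at x) u
     - frechet_derivative (\<lambda>y. \<beta> y u w) (at x) v
     + frechet_derivative (\<lambda>y. \<beta> y u v) (at x) w"

definition closed_form2 ::
    "('a, 'e::euclidean_space) chart set \<Rightarrow> ('a, 'e) form2 \<Rightarrow> bool" where
  "closed_form2 A \<omega> \<longleftrightarrow>
     (\<forall>c\<in>A. \<forall>x\<in>chart_img c. \<forall>u v w. ext_deriv2 (form2_rep A c \<omega>) x u v w = 0)"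

definition nondegenerate_form2 ::
    "'a topology \<Rightarrow> ('a, 'e::euclidean_space) chart set \<Rightarrow> ('a, 'e) form2 \<Rightarrow> bool" where
  "nondegenerate_form2 M A \<omega> \<longleftrightarrow>
     (\<forall>p\<in>topspace M. \<forall>X\<in>tangent_space A p.
        (\<forall>Y\<in>tangent_space A p. \<omega> p X Y = 0) \<longrightarrow> X = tv_zero)"

definition symplectic_form ::
    "'a topology \<Rightarrow> ('a, 'e::euclidean_space) chart set \<Rightarrow> ('a, 'e) form2 \<Rightarrow> bool" where
  "symplectic_form M A \<omega> \<longleftrightarrow>
     \<omega> \<in> forms2 M A \<and> closed_form2 A \<omega> \<and> nondegenerate_form2 M A \<omega>"

section \<open>Almost complex structures\<close>

text \<open>The values of \<open>J p\<close> outside the tangent space at \<open>p\<close> are irrelevant.\<close>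

type_synonym ('a, 'e) endo = "'a \<Rightarrow> ('a, 'e) tvec \<Rightarrow> ('a, 'e) tvec"

definition endo_rep ::
    "('a, 'e::euclidean_space) chart set \<Rightarrow> ('a, 'e) chart \<Rightarrow> ('a, 'e) endo \<Rightarrow>
     'e \<Rightarrow> 'e \<Rightarrow> 'e" where
  "endo_rep A c J x u = (let p = chart_inv c x in J p (coord_vec A c p u) c)"

definition almost_complex_structure ::
    "'a topology \<Rightarrow> ('a, 'e::euclidean_space) chart set \<Rightarrow> ('a, 'e) endo \<Rightarrow> bool" where
  "almost_complex_structure M A J \<longleftrightarrow>
     (\<forall>p\<in>topspace M. \<forall>X\<in>tangent_space A p. J p X \<in> tangent_space A p) \<and>
     (\<forall>p\<in>topspace M. \<forall>X\<in>tangent_space A p. \<forall>Y\<in>tangent_space A p. \<forall>a b.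
        J p (tv_lincomb a X b Y) = tv_lincomb a (J p X) b (J p Y)) \<and>
     (\<forall>p\<in>topspace M. \<forall>X\<in>tangent_space A p. J p (J p X) = (\<lambda>c. - X c)) \<and>
     (\<forall>c\<in>A. \<forall>u. smooth_on (chart_img c) (\<lambda>x. endo_rep A c J x u))"

definition invariant_forms2 ::
    "'a topology \<Rightarrow> ('a, 'e::euclidean_space) chart set \<Rightarrow> ('a, 'e) endo \<Rightarrow>
     ('a, 'e) form2 set" where
  "invariant_forms2 M A J = {\<alpha> \<in> forms2 M A.
     \<forall>p\<in>topspace M. \<forall>X\<in>tangent_space A p. \<forall>Y\<in>tangent_space A p.
       \<alpha> p (J p X) (J p Y) = \<alpha> p X Y}"

definition anti_invariant_forms2 ::
    "'a topology \<Rightarrow> ('a, 'e::euclidean_space) chart set \<Rightarrow> ('a, 'e) endo \<Rightarrow>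
     ('a, 'e) form2 set" where
  "anti_invariant_forms2 M A J = {\<alpha> \<in> forms2 M A.
     \<forall>p\<in>topspace M. \<forall>X\<in>tangent_space A p. \<forall>Y\<in>tangent_space A p.
       \<alpha> p (J p X) (J p Y) = - \<alpha> p X Y}"

text \<open>\<open>\<alpha>\<close> is the anti-invariant component of \<open>\<omega>\<close> in the direct sum decomposition of the
  2-forms into invariant and anti-invariant ones.\<close>

definition is_anti_invariant_part ::
    "'a topology \<Rightarrow> ('a, 'e::euclidean_space) chart set \<Rightarrow> ('a, 'e) endo \<Rightarrow>
     ('a, 'e) form2 \<Rightarrow> ('a, 'e) form2 \<Rightarrow> bool" where
  "is_anti_invariant_part M A J \<omega> \<alpha> \<longleftrightarrow>
     \<alpha> \<in> anti_invariant_forms2 M A J \<and>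
     (\<exists>\<beta>\<in>invariant_forms2 M A J. \<omega> = (\<lambda>p X Y. \<beta> p X Y + \<alpha> p X Y))"

definition J_positive ::
    "'a topology \<Rightarrow> ('a, 'e::euclidean_space) chart set \<Rightarrow> ('a, 'e) endo \<Rightarrow>
     ('a, 'e) form2 \<Rightarrow> bool" where
  "J_positive M A J \<omega> \<longleftrightarrow>
     (\<forall>p\<in>topspace M. \<forall>X\<in>tangent_space A p. X \<noteq> tv_zero \<longrightarrow> \<omega> p X (J p X) > 0)"

definition tamed_symplectic ::
    "'a topology \<Rightarrow> ('a, 'e::euclidean_space) chart set \<Rightarrow> ('a, 'e) endo \<Rightarrow>
     ('a, 'e) form2 \<Rightarrow> bool" where
  "tamed_symplectic M A J \<omega> \<longleftrightarrow> symplectic_form M A \<omega> \<and> J_positive M A J \<omega>"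

definition compatible_symplectic ::
    "'a topology \<Rightarrow> ('a, 'e::euclidean_space) chart set \<Rightarrow> ('a, 'e) endo \<Rightarrow>
     ('a, 'e) form2 \<Rightarrow> bool" where
  "compatible_symplectic M A J \<omega> \<longleftrightarrow>
     symplectic_form M A \<omega> \<and> J_positive M A J \<omega> \<and> \<omega> \<in> invariant_forms2 M A J"

end

theory Submission
  imports Defs
begin

text \<open>A compatible form is the same as a tamed form with vanishing anti-invariant part, so both
  implications come down to cancelling anti-invariant parts by real linear combinations of tamed
  forms. Such combinations are closed, and nondegeneracy is automatic once a form is positive,
  because \<open>X\<close> pairs nontrivially with \<open>JX\<close>; only positivity has to be watched
  (\<open>tamed_lincomb2\<close>).

  If \<open>\<omega>\<close> and \<open>\<omega>'\<close> are tamed with anti-invariant parts \<open>\<alpha>\<close> and \<open>-\<alpha>\<close>, then \<open>\<omega> + \<omega>'\<close> is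
  positive and invariant, hence compatible (\<open>compatible_if_opposite_parts\<close>). To start from an
  arbitrary tamed \<open>\<omega>\<close> one needs that it has an anti-invariant part
  \<open>\<alpha> = (\<omega> - \<omega>(J\<cdot>,J\<cdot>)) / 2\<close>, the point being that \<open>\<omega>(J\<cdot>,J\<cdot>)\<close> is again a smooth form
  (\<open>pullback_J_forms2\<close>, \<open>anti_invariant_part_exists\<close>).

  Conversely, let \<open>\<omega>\<^sub>0\<close> be compatible and let \<open>\<omega>\<close> be tamed with anti-invariant part \<open>\<alpha>\<close>. Then
  \<open>C \<omega>\<^sub>0 - \<omega>\<close> has anti-invariant part \<open>-\<alpha>\<close> for every real \<open>C\<close>, and it is positive when \<open>C\<close> exceeds
  the supremum of \<open>\<omega>(X,JX) / \<omega>\<^sub>0(X,JX)\<close>. This supremum is finite since \<open>M\<close> is compact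
  (\<open>positive_form_dominates\<close>); it is the only use of compactness.\<close>

section \<open>Calculus of smooth maps\<close>

lemma has_derivative_frechet:
  assumes "f differentiable (at x)"
  shows "(f has_derivative frechet_derivative f (at x)) (at x)"
  using assms frechet_derivative_works by blast

lemma Ck_on_cong:
  assumes "open S" "Ck_on k S f" "\<And>x. x \<in> S \<Longrightarrow> f x = g x"
  shows "Ck_on k S g"
  using assms(2,3)
proof (induction k arbitrary: f g)
  case 0
  then show ?case using continuous_on_cong[of S S f g] by simp
next
  case (Suc k)
  have D: "(g has_derivative frechet_derivative f (at x)) (at x)" if "x \<in> S" for x
    using has_derivative_transform_within_open[OF has_derivative_frechet assms(1) that Suc.prems(2)]
      Suc.prems(1) that by auto
  have "frechet_derivative f (at x) v = frechet_derivative g (at x) v" if "x \<in> S" for x v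
    using frechet_derivative_at[OF D[OF that]] by simp
  then have "Ck_on k S (\<lambda>x. frechet_derivative g (at x) v)" for v
    using Suc.IH[of "\<lambda>x. frechet_derivative f (at x) v" "\<lambda>x. frechet_derivative g (at x) v"]
      Suc.prems(1) by auto
  moreover have "g differentiable (at x)" if "x \<in> S" for x
    using D[OF that] unfolding differentiable_def by blast
  ultimately show ?case by simp
qed

lemma Ck_on_SucI:
  assumes "open S"
    and "\<And>x. x \<in> S \<Longrightarrow> (f has_derivative D x) (at x)"
    and "\<And>v. Ck_on k S (\<lambda>x. D x v)"
  shows "Ck_on (Suc k) S f"
proof -
  have "D x v = frechet_derivative f (at x) v" if "x \<in> S" for x v
    using frechet_derivative_at[OF assms(2)[OF that]] by simp
  then have "Ck_on k S (\<lambda>x. frechet_derivative f (at x) v)" for v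
    by (rule Ck_on_cong[OF assms(1) assms(3)])
  moreover have "f differentiable (at x)" if "x \<in> S" for x
    using assms(2)[OF that] unfolding differentiable_def by blast
  ultimately show ?thesis by simp
qed

lemma smooth_on_cong:
  assumes "open S" "smooth_on S f" "\<And>x. x \<in> S \<Longrightarrow> f x = g x"
  shows "smooth_on S g"
  using assms Ck_on_cong unfolding smooth_on_def by blast

lemma smooth_on_imp_continuous_on: "smooth_on S f \<Longrightarrow> continuous_on S f"
  unfolding smooth_on_def by (metis Ck_on.simps(1))

lemma smooth_on_has_derivative:
  assumes "smooth_on S f" "x \<in> S"
  shows "(f has_derivative frechet_derivative f (at x)) (at x)"
  using assms has_derivative_frechet unfolding smooth_on_def by (metis Ck_on.simps(2))

lemma smooth_on_frechet_derivative:
  "smooth_on S f \<Longrightarrow> smooth_on S (\<lambda>x. frechet_derivative f (at x) v)"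
  unfolding smooth_on_def by (metis Ck_on.simps(2))

lemma Ck_on_const: "Ck_on k S (\<lambda>x. c)"
  by (induction k arbitrary: c) (auto simp: frechet_derivative_const)

lemma smooth_on_const: "smooth_on S (\<lambda>x. c)"
  unfolding smooth_on_def using Ck_on_const by blast

lemma Ck_on_add:
  assumes "open S" "Ck_on k S f" "Ck_on k S g"
  shows "Ck_on k S (\<lambda>x. f x + g x)"
  using assms(2,3)
proof (induction k arbitrary: f g)
  case 0
  then show ?case by (simp add: continuous_on_add)
next
  case (Suc k)
  show ?case
    by (rule Ck_on_SucI[OF assms(1)],
        rule has_derivative_add[OF has_derivative_frechet has_derivative_frechet])
      (use Suc in auto)
qed

lemma smooth_on_add:
  assumes "open S" "smooth_on S f" "smooth_on S g"
  shows "smooth_on S (\<lambda>x. f x + g x)"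
  using assms Ck_on_add unfolding smooth_on_def by blast

lemma smooth_on_sum:
  assumes "open S" "\<And>i. i \<in> I \<Longrightarrow> smooth_on S (f i)"
  shows "smooth_on S (\<lambda>x. \<Sum>i\<in>I. f i x)"
  using assms(2)
  by (induction I rule: infinite_finite_induct)
    (auto intro: smooth_on_const smooth_on_add[OF assms(1)])

lemma smooth_on_bounded_linear:
  assumes "open S" "bounded_linear L" "smooth_on S f"
  shows "smooth_on S (\<lambda>x. L (f x))"
proof -
  have "Ck_on k S (\<lambda>x. L (f x))" if "smooth_on S f" for k f
    using that
  proof (induction k arbitrary: f)
    case 0
    then show ?case
      using bounded_linear.continuous_on[OF assms(2)] smooth_on_imp_continuous_on by auto
  next
    case (Suc k)
    show ?case
      by (rule Ck_on_SucI[OF assms(1)],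
          rule bounded_linear.has_derivative[OF assms(2) smooth_on_has_derivative[OF Suc.prems]],
          assumption, rule Suc.IH[OF smooth_on_frechet_derivative[OF Suc.prems]])
  qed
  then show ?thesis using assms(3) unfolding smooth_on_def by blast
qed

text \<open>The induction is on the order of differentiability of the product while the factors stay
  smooth: the product rule then only needs that directional derivatives of smooth maps are
  smooth.\<close>

lemma smooth_on_mult:
  fixes f g :: "'e::euclidean_space \<Rightarrow> real"
  assumes "open S" "smooth_on S f" "smooth_on S g"
  shows "smooth_on S (\<lambda>x. f x * g x)"
proof -
  have "Ck_on k S (\<lambda>x. f x * g x)" if "smooth_on S f" "smooth_on S g" for k and f g :: "'e \<Rightarrow> real"
    using that
  proof (induction k arbitrary: f g)
    case 0
    then show ?case by (simp add: continuous_on_mult smooth_on_imp_continuous_on)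
  next
    case (Suc k)
    note f = Suc.prems(1) and g = Suc.prems(2)
    show ?case
      by (rule Ck_on_SucI[OF assms(1)],
          rule has_derivative_mult[OF smooth_on_has_derivative[OF f] smooth_on_has_derivative[OF g]])
        (auto intro!: Ck_on_add[OF assms(1)] Suc.IH smooth_on_frechet_derivative f g)
  qed
  then show ?thesis using assms(2,3) unfolding smooth_on_def by blast
qed

section \<open>Charts and tangent vectors\<close>

locale smooth_atlas_on =
  fixes M :: "'a topology" and A :: "('a, 'e::euclidean_space) chart set"
  assumes atlas: "smooth_atlas M A"
begin

lemma chart: "c \<in> A \<Longrightarrow> is_chart M c"
  using atlas unfolding smooth_atlas_def by blast

lemma chart_dom_subset: "c \<in> A \<Longrightarrow> chart_dom c \<subseteq> topspace M"
  using chart openin_subset unfolding is_chart_def by blast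

lemma open_chart_img: "c \<in> A \<Longrightarrow> open (chart_img c)"
  using chart unfolding is_chart_def by blast

lemma obtain_chart:
  assumes "p \<in> topspace M"
  obtains c where "c \<in> A" "p \<in> chart_dom c"
  using assms atlas unfolding smooth_atlas_def by blast

lemma chart_inj:
  assumes "c \<in> A"
  shows "inj_on (chart_map c) (chart_dom c)"
proof -
  have "topspace (subtopology M (chart_dom c)) = chart_dom c"
    using chart_dom_subset[OF assms] by (simp add: topspace_subtopology Int_absorb1)
  then show ?thesis
    using chart[OF assms] homeomorphic_imp_injective_map unfolding is_chart_def by metis
qed

lemma chart_inv_map:
  "c \<in> A \<Longrightarrow> p \<in> chart_dom c \<Longrightarrow> chart_inv c (chart_map c p) = p"
  unfolding chart_inv_def by (simp add: chart_inj)

lemma chart_map_inv: "x \<in> chart_img c \<Longrightarrow> chart_map c (chart_inv c x) = x"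
  unfolding chart_inv_def chart_img_def by (simp add: f_inv_into_f)

lemma chart_inv_in_dom: "x \<in> chart_img c \<Longrightarrow> chart_inv c x \<in> chart_dom c"
  unfolding chart_inv_def chart_img_def by (simp add: inv_into_into)

lemma chart_inv_in_topspace: "c \<in> A \<Longrightarrow> x \<in> chart_img c \<Longrightarrow> chart_inv c x \<in> topspace M"
  using subsetD[OF chart_dom_subset chart_inv_in_dom] .

lemma chart_map_in_img: "p \<in> chart_dom c \<Longrightarrow> chart_map c p \<in> chart_img c"
  unfolding chart_img_def by blast

lemma open_chart_image:
  assumes "c \<in> A" "openin M U" "U \<subseteq> chart_dom c"
  shows "open (chart_map c ` U)"
proof -
  have "open_map (subtopology M (chart_dom c)) (top_of_set (chart_img c)) (chart_map c)"
    using chart[OF assms(1)] homeomorphic_imp_open_map unfolding is_chart_def by blast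
  moreover have "openin (subtopology M (chart_dom c)) U"
    using assms(2,3) by (metis openin_subtopology_Int Int_absorb2)
  ultimately have "openin (top_of_set (chart_img c)) (chart_map c ` U)"
    unfolding open_map_def by blast
  then show ?thesis using openin_open_eq[OF open_chart_img[OF assms(1)]] by blast
qed

lemma openin_chart_preimage:
  assumes "c \<in> A" "open V"
  shows "openin M {p \<in> chart_dom c. chart_map c p \<in> V}"
proof -
  have top: "topspace (subtopology M (chart_dom c)) = chart_dom c"
    using chart_dom_subset[OF assms(1)] by (simp add: topspace_subtopology Int_absorb1)
  have "continuous_map (subtopology M (chart_dom c)) (top_of_set (chart_img c)) (chart_map c)"
    using chart[OF assms(1)] homeomorphic_imp_continuous_map unfolding is_chart_def by blast
  then have "continuous_map (subtopology M (chart_dom c)) euclidean (chart_map c)"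
    by (simp add: continuous_map_in_subtopology)
  then have "openin (subtopology M (chart_dom c)) {p \<in> chart_dom c. chart_map c p \<in> V}"
    using openin_continuous_map_preimage[of "subtopology M (chart_dom c)" euclidean "chart_map c" V]
      assms(2) unfolding top by simp
  then show ?thesis
    using chart[OF assms(1)] openin_open_subtopology unfolding is_chart_def by blast
qed

lemma transition_has_derivative:
  assumes "c \<in> A" "d \<in> A" "p \<in> chart_dom c" "p \<in> chart_dom d"
  shows "((chart_map d \<circ> chart_inv c) has_derivative
    frechet_derivative (chart_map d \<circ> chart_inv c) (at (chart_map c p))) (at (chart_map c p))"
proof -
  have "smooth_on (chart_map c ` (chart_dom c \<inter> chart_dom d)) (chart_map d \<circ> chart_inv c)"
    using atlas assms unfolding smooth_atlas_def by blast
  then show ?thesis using smooth_on_has_derivative assms by blast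
qed

text \<open>The cocycle rule for the differentials of the coordinate changes: it is the chain rule,
  applied on the open set of coordinates where all three charts are defined.\<close>

lemma transition_derivative_compose:
  assumes A: "c \<in> A" "d \<in> A" "e \<in> A"
    and p: "p \<in> chart_dom c" "p \<in> chart_dom d" "p \<in> chart_dom e"
  shows "frechet_derivative (chart_map e \<circ> chart_inv d) (at (chart_map d p))
      (frechet_derivative (chart_map d \<circ> chart_inv c) (at (chart_map c p)) u) =
    frechet_derivative (chart_map e \<circ> chart_inv c) (at (chart_map c p)) u"
proof -
  let ?U = "chart_dom c \<inter> chart_dom d \<inter> chart_dom e"
  have dp: "(chart_map d \<circ> chart_inv c) (chart_map c p) = chart_map d p"
    using chart_inv_map A p by simp
  have op: "open (chart_map c ` ?U)"
    using open_chart_image[OF A(1), of ?U] chart A unfolding is_chart_def by blast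
  have "((chart_map e \<circ> chart_inv d) \<circ> (chart_map d \<circ> chart_inv c) has_derivative
     frechet_derivative (chart_map e \<circ> chart_inv d) (at (chart_map d p)) \<circ>
     frechet_derivative (chart_map d \<circ> chart_inv c) (at (chart_map c p))) (at (chart_map c p))"
    using transition_has_derivative A p by (intro diff_chain_at) (simp_all only: dp)
  then have "((chart_map e \<circ> chart_inv c) has_derivative
     frechet_derivative (chart_map e \<circ> chart_inv d) (at (chart_map d p)) \<circ>
     frechet_derivative (chart_map d \<circ> chart_inv c) (at (chart_map c p))) (at (chart_map c p))"
    by (rule has_derivative_transform_within_open[OF _ op]) (use p A in \<open>auto simp: chart_inv_map\<close>)
  from frechet_derivative_at[OF this] show ?thesis by (metis comp_apply)
qed

lemma coord_vec_self:
  assumes "c \<in> A" "p \<in> chart_dom c"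
  shows "coord_vec A c p u c = u"
proof -
  have "((chart_map c \<circ> chart_inv c) has_derivative (\<lambda>u. u)) (at (chart_map c p))"
    by (rule has_derivative_transform_within_open[OF has_derivative_ident open_chart_img[OF assms(1)]])
      (simp_all only: chart_map_in_img[OF assms(2)] chart_map_inv comp_apply)
  from frechet_derivative_at[OF this] show ?thesis
    using assms unfolding coord_vec_def by (metis (full_types))
qed

text \<open>Together with \<open>coord_vec_self\<close>, the next two lemmas say that \<open>coord_vec A c p\<close> and
  \<open>X \<mapsto> X c\<close> are inverse identifications of the model space with the tangent space at \<open>p\<close>; the
  cocycle rule is what makes \<open>coord_vec A c p\<close> take values in tangent vectors.\<close>

lemma coord_vec_tangent:
  assumes "c \<in> A" "p \<in> chart_dom c"
  shows "coord_vec A c p u \<in> tangent_space A p"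
proof -
  let ?X = "coord_vec A c p u"
  have "?X e = frechet_derivative (chart_map e \<circ> chart_inv d) (at (chart_map d p)) (?X d)"
    if "d \<in> A" "e \<in> A" "p \<in> chart_dom d" "p \<in> chart_dom e" for d e
    using transition_derivative_compose[OF assms(1) that(1,2) assms(2) that(3,4)] that
    unfolding coord_vec_def by (simp only: simp_thms if_True)
  moreover have "?X d = 0" if "d \<notin> A \<or> p \<notin> chart_dom d" for d
    using that unfolding coord_vec_def by meson
  ultimately show ?thesis unfolding tangent_space_def by blast
qed

lemma tangent_eq_coord_vec:
  assumes "c \<in> A" "p \<in> chart_dom c" "X \<in> tangent_space A p"
  shows "coord_vec A c p (X c) = X"
proof
  fix d
  show "coord_vec A c p (X c) d = X d"
  proof (cases "d \<in> A \<and> p \<in> chart_dom d")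
    case True
    then have "X d = frechet_derivative (chart_map d \<circ> chart_inv c) (at (chart_map c p)) (X c)"
      using assms unfolding tangent_space_def by blast
    then show ?thesis using True unfolding coord_vec_def by (simp only: if_True simp_thms)
  next
    case False
    then have "X d = 0" using assms(3) unfolding tangent_space_def by blast
    then show ?thesis using False unfolding coord_vec_def by (simp only: if_False)
  qed
qed

lemma coord_vec_lincomb:
  assumes "c \<in> A" "p \<in> chart_dom c"
  shows "coord_vec A c p (a *\<^sub>R u + b *\<^sub>R v) = tv_lincomb a (coord_vec A c p u) b (coord_vec A c p v)"
proof
  fix d
  show "coord_vec A c p (a *\<^sub>R u + b *\<^sub>R v) d
      = tv_lincomb a (coord_vec A c p u) b (coord_vec A c p v) d"
  proof (cases "d \<in> A \<and> p \<in> chart_dom d")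
    case True
    then have "linear (frechet_derivative (chart_map d \<circ> chart_inv c) (at (chart_map c p)))"
      using transition_has_derivative[of c d p] assms has_derivative_linear by blast
    then show ?thesis
      using True unfolding coord_vec_def tv_lincomb_def by (simp add: linear_add linear_scale)
  qed (auto simp: coord_vec_def tv_lincomb_def)
qed

lemma tv_lincomb_tangent:
  assumes "p \<in> topspace M" "X \<in> tangent_space A p" "Y \<in> tangent_space A p"
  shows "tv_lincomb a X b Y \<in> tangent_space A p"
proof -
  obtain c where c: "c \<in> A" "p \<in> chart_dom c" using obtain_chart assms(1) by blast
  then have "tv_lincomb a X b Y = coord_vec A c p (a *\<^sub>R X c + b *\<^sub>R Y c)"
    using assms by (simp add: coord_vec_lincomb tangent_eq_coord_vec)
  then show ?thesis using coord_vec_tangent c by simp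
qed

section \<open>Coordinate representations of forms\<close>

lemma forms2_zero:
  assumes "\<omega> \<in> forms2 M A" "\<not> (p \<in> topspace M \<and> X \<in> tangent_space A p \<and> Y \<in> tangent_space A p)"
  shows "\<omega> p X Y = 0"
  using assms unfolding forms2_def by blast

lemma forms2_skew:
  assumes "\<omega> \<in> forms2 M A" "p \<in> topspace M" "X \<in> tangent_space A p" "Y \<in> tangent_space A p"
  shows "\<omega> p Y X = - \<omega> p X Y"
  using assms unfolding forms2_def by blast

lemma forms2_lincomb_left:
  assumes "\<omega> \<in> forms2 M A" "p \<in> topspace M"
    and "X \<in> tangent_space A p" "Y \<in> tangent_space A p" "Z \<in> tangent_space A p"
  shows "\<omega> p (tv_lincomb a X b Y) Z = a * \<omega> p X Z + b * \<omega> p Y Z"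
  using assms unfolding forms2_def by blast

lemma forms2_lincomb_right:
  assumes "\<omega> \<in> forms2 M A" "p \<in> topspace M"
    and "X \<in> tangent_space A p" "Y \<in> tangent_space A p" "Z \<in> tangent_space A p"
  shows "\<omega> p Z (tv_lincomb a X b Y) = a * \<omega> p Z X + b * \<omega> p Z Y"
proof -
  have "\<omega> p Z (tv_lincomb a X b Y) = - \<omega> p (tv_lincomb a X b Y) Z"
    by (rule forms2_skew[OF assms(1,2) tv_lincomb_tangent[OF assms(2-4)] assms(5)])
  then show ?thesis
    using forms2_lincomb_left[OF assms] forms2_skew[OF assms(1,2,3,5)] forms2_skew[OF assms(1,2,4,5)]
    by simp
qed

lemma form2_rep_bilinear:
  assumes "\<omega> \<in> forms2 M A" "c \<in> A" "x \<in> chart_img c"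
  shows "bilinear (form2_rep A c \<omega> x)"
proof -
  let ?p = "chart_inv c x"
  have p: "?p \<in> chart_dom c" "?p \<in> topspace M"
    by (rule chart_inv_in_dom[OF assms(3)], rule chart_inv_in_topspace[OF assms(2,3)])
  note T = coord_vec_tangent[OF assms(2) p(1)]
  have left: "form2_rep A c \<omega> x (a *\<^sub>R u + b *\<^sub>R v) w
      = a * form2_rep A c \<omega> x u w + b * form2_rep A c \<omega> x v w" for a b u v w
    unfolding form2_rep_def Let_def coord_vec_lincomb[OF assms(2) p(1)]
    by (rule forms2_lincomb_left[OF assms(1) p(2) T T T])
  have right: "form2_rep A c \<omega> x w (a *\<^sub>R u + b *\<^sub>R v)
      = a * form2_rep A c \<omega> x w u + b * form2_rep A c \<omega> x w v" for a b u v w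
    unfolding form2_rep_def Let_def coord_vec_lincomb[OF assms(2) p(1)]
    by (rule forms2_lincomb_right[OF assms(1) p(2) T T T])
  show ?thesis
    unfolding bilinear_def
  proof (intro conjI allI linearI)
    fix w u v :: 'e and r :: real
    show "form2_rep A c \<omega> x w (u + v) = form2_rep A c \<omega> x w u + form2_rep A c \<omega> x w v"
      using right[of w 1 u 1 v] by simp
    show "form2_rep A c \<omega> x (u + v) w = form2_rep A c \<omega> x u w + form2_rep A c \<omega> x v w"
      using left[of 1 u 1 v w] by simp
    show "form2_rep A c \<omega> x w (r *\<^sub>R u) = r *\<^sub>R form2_rep A c \<omega> x w u"
      using right[of w r u 0 u] by simp
    show "form2_rep A c \<omega> x (r *\<^sub>R u) w = r *\<^sub>R form2_rep A c \<omega> x u w"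
      using left[of r u 0 u w] by simp
  qed
qed

lemma forms2I:
  assumes "\<And>p X Y. \<not> (p \<in> topspace M \<and> X \<in> tangent_space A p \<and> Y \<in> tangent_space A p) \<Longrightarrow>
      \<omega> p X Y = 0"
    and "\<And>p X Y. p \<in> topspace M \<Longrightarrow> X \<in> tangent_space A p \<Longrightarrow> Y \<in> tangent_space A p \<Longrightarrow>
      \<omega> p Y X = - \<omega> p X Y"
    and "\<And>p X Y Z a b. p \<in> topspace M \<Longrightarrow> X \<in> tangent_space A p \<Longrightarrow> Y \<in> tangent_space A p \<Longrightarrow>
      Z \<in> tangent_space A p \<Longrightarrow> \<omega> p (tv_lincomb a X b Y) Z = a * \<omega> p X Z + b * \<omega> p Y Z"
    and "\<And>c u v. c \<in> A \<Longrightarrow> smooth_on (chart_img c) (\<lambda>x. form2_rep A c \<omega> x u v)"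
  shows "\<omega> \<in> forms2 M A"
  unfolding forms2_def mem_Collect_eq by (intro conjI ballI allI impI assms)

lemma smooth_form2_rep:
  assumes "\<omega> \<in> forms2 M A" "c \<in> A"
  shows "smooth_on (chart_img c) (\<lambda>x. form2_rep A c \<omega> x u v)"
  using assms unfolding forms2_def by blast

lemma bilinear_expand:
  fixes B :: "'e \<Rightarrow> 'e \<Rightarrow> real"
  assumes "bilinear B"
  shows "B u v = (\<Sum>i\<in>Basis. \<Sum>j\<in>Basis. (u \<bullet> i) * ((v \<bullet> j) * B i j))"
proof -
  have "B u v = B (\<Sum>i\<in>Basis. (u \<bullet> i) *\<^sub>R i) (\<Sum>j\<in>Basis. (v \<bullet> j) *\<^sub>R j)"
    by (simp add: euclidean_representation)
  also have "\<dots> = (\<Sum>(i,j)\<in>Basis \<times> Basis. (u \<bullet> i) * ((v \<bullet> j) * B i j))"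
    unfolding bilinear_sum[OF assms]
    by (simp add: bilinear_lmul[OF assms] bilinear_rmul[OF assms] split_def mult.left_commute)
  finally show ?thesis by (simp add: sum.cartesian_product)
qed

text \<open>Smoothness of a form is only required on constant coordinate fields; expanding in a basis
  extends it to arbitrary smooth local vector fields.\<close>

lemma smooth_form2_rep_fields:
  assumes "\<omega> \<in> forms2 M A" "c \<in> A" "smooth_on (chart_img c) f" "smooth_on (chart_img c) g"
  shows "smooth_on (chart_img c) (\<lambda>x. form2_rep A c \<omega> x (f x) (g x))"
proof -
  note op = open_chart_img[OF assms(2)]
  have "smooth_on (chart_img c) (\<lambda>x. \<Sum>i\<in>Basis. \<Sum>j\<in>Basis.
      (f x \<bullet> i) * ((g x \<bullet> j) * form2_rep A c \<omega> x i j))"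
    by (intro smooth_on_sum[OF op] smooth_on_mult[OF op] smooth_form2_rep assms
        smooth_on_bounded_linear[OF op bounded_linear_inner_left])
  then show ?thesis
    by (rule smooth_on_cong[OF op]) (simp add: bilinear_expand[OF form2_rep_bilinear[OF assms(1,2)], symmetric])
qed

definition lincomb2 ::
    "real \<Rightarrow> ('a, 'e) form2 \<Rightarrow> real \<Rightarrow> ('a, 'e) form2 \<Rightarrow> ('a, 'e) form2" where
  "lincomb2 a \<sigma> b \<tau> = (\<lambda>p X Y. a * \<sigma> p X Y + b * \<tau> p X Y)"

lemma form2_rep_lincomb2:
  "form2_rep A c (lincomb2 a \<sigma> b \<tau>) x u v
    = a * form2_rep A c \<sigma> x u v + b * form2_rep A c \<tau> x u v"
  by (simp add: form2_rep_def lincomb2_def Let_def)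

lemma lincomb2_forms2:
  assumes "\<sigma> \<in> forms2 M A" "\<tau> \<in> forms2 M A"
  shows "lincomb2 a \<sigma> b \<tau> \<in> forms2 M A"
proof -
  have smooth: "smooth_on (chart_img c) (\<lambda>x. form2_rep A c (lincomb2 a \<sigma> b \<tau>) x u v)" if "c \<in> A" for c u v
    unfolding form2_rep_lincomb2
    by (intro smooth_on_add smooth_on_mult smooth_on_const smooth_form2_rep open_chart_img assms that)
  show ?thesis
  proof (rule forms2I)
    fix p X Y
    assume "\<not> (p \<in> topspace M \<and> X \<in> tangent_space A p \<and> Y \<in> tangent_space A p)"
    then show "lincomb2 a \<sigma> b \<tau> p X Y = 0"
      using forms2_zero[OF assms(1), of p X Y] forms2_zero[OF assms(2), of p X Y]
      by (simp only: lincomb2_def simp_thms mult_zero_right add_0)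
  next
    fix p X Y
    assume T: "p \<in> topspace M" "X \<in> tangent_space A p" "Y \<in> tangent_space A p"
    show "lincomb2 a \<sigma> b \<tau> p Y X = - lincomb2 a \<sigma> b \<tau> p X Y"
      using forms2_skew[OF assms(1) T] forms2_skew[OF assms(2) T] by (simp add: lincomb2_def)
  next
    fix p X Y Z r s
    assume T: "p \<in> topspace M" "X \<in> tangent_space A p" "Y \<in> tangent_space A p" "Z \<in> tangent_space A p"
    show "lincomb2 a \<sigma> b \<tau> p (tv_lincomb r X s Y) Z
        = r * lincomb2 a \<sigma> b \<tau> p X Z + s * lincomb2 a \<sigma> b \<tau> p Y Z"
      unfolding lincomb2_def forms2_lincomb_left[OF assms(1) T] forms2_lincomb_left[OF assms(2) T]
      by (simp add: algebra_simps)
  qed (rule smooth)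
qed

lemma closed_lincomb2:
  assumes "\<sigma> \<in> forms2 M A" "\<tau> \<in> forms2 M A" "closed_form2 A \<sigma>" "closed_form2 A \<tau>"
  shows "closed_form2 A (lincomb2 a \<sigma> b \<tau>)"
  unfolding closed_form2_def
proof (intro ballI allI)
  fix c x u v w
  assume c: "c \<in> A" and x: "x \<in> chart_img c"
  have D: "frechet_derivative (\<lambda>y. form2_rep A c (lincomb2 a \<sigma> b \<tau>) y r s) (at x) t
      = a * frechet_derivative (\<lambda>y. form2_rep A c \<sigma> y r s) (at x) t
        + b * frechet_derivative (\<lambda>y. form2_rep A c \<tau> y r s) (at x) t" for r s t
  proof -
    have "((\<lambda>y. form2_rep A c (lincomb2 a \<sigma> b \<tau>) y r s) has_derivative
        (\<lambda>t. a * frechet_derivative (\<lambda>y. form2_rep A c \<sigma> y r s) (at x) t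
           + b * frechet_derivative (\<lambda>y. form2_rep A c \<tau> y r s) (at x) t)) (at x)"
      unfolding form2_rep_lincomb2
      by (intro has_derivative_add has_derivative_mult_right
          smooth_on_has_derivative[OF smooth_form2_rep[OF _ c] x] assms)
    from frechet_derivative_at[OF this] show ?thesis by metis
  qed
  have "ext_deriv2 (form2_rep A c \<sigma>) x u v w = 0" "ext_deriv2 (form2_rep A c \<tau>) x u v w = 0"
    using assms(3,4) c x unfolding closed_form2_def by blast+
  moreover have "ext_deriv2 (form2_rep A c (lincomb2 a \<sigma> b \<tau>)) x u v w =
      a * ext_deriv2 (form2_rep A c \<sigma>) x u v w + b * ext_deriv2 (form2_rep A c \<tau>) x u v w"
    unfolding ext_deriv2_def D by (simp add: algebra_simps)
  ultimately show "ext_deriv2 (form2_rep A c (lincomb2 a \<sigma> b \<tau>)) x u v w = 0" by simp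
qed

end

section \<open>Splitting off the anti-invariant part\<close>

locale almost_complex_atlas = smooth_atlas_on M A
  for M :: "'a topology" and A :: "('a, 'e::euclidean_space) chart set" +
  fixes J :: "('a, 'e) endo"
  assumes acs: "almost_complex_structure M A J"
begin

lemma J_tangent: "p \<in> topspace M \<Longrightarrow> X \<in> tangent_space A p \<Longrightarrow> J p X \<in> tangent_space A p"
  using acs unfolding almost_complex_structure_def by blast

lemma J_lincomb:
  "p \<in> topspace M \<Longrightarrow> X \<in> tangent_space A p \<Longrightarrow> Y \<in> tangent_space A p \<Longrightarrow>
   J p (tv_lincomb a X b Y) = tv_lincomb a (J p X) b (J p Y)"
  using acs unfolding almost_complex_structure_def by blast

lemma J_J:
  assumes "p \<in> topspace M" "X \<in> tangent_space A p"
  shows "J p (J p X) = tv_lincomb (-1) X 0 X"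
proof -
  have "J p (J p X) = (\<lambda>c. - X c)"
    using acs assms unfolding almost_complex_structure_def by blast
  then show ?thesis unfolding tv_lincomb_def by simp
qed

lemma smooth_endo_rep: "c \<in> A \<Longrightarrow> smooth_on (chart_img c) (\<lambda>x. endo_rep A c J x u)"
  using acs unfolding almost_complex_structure_def by blast

lemma J_coord_vec:
  assumes "c \<in> A" "x \<in> chart_img c"
  shows "J (chart_inv c x) (coord_vec A c (chart_inv c x) u)
    = coord_vec A c (chart_inv c x) (endo_rep A c J x u)"
  unfolding endo_rep_def Let_def
  by (rule tangent_eq_coord_vec[symmetric, OF assms(1) chart_inv_in_dom[OF assms(2)]
      J_tangent[OF chart_inv_in_topspace[OF assms]
        coord_vec_tangent[OF assms(1) chart_inv_in_dom[OF assms(2)]]]])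

lemma endo_rep_linear:
  assumes "c \<in> A" "x \<in> chart_img c"
  shows "linear (endo_rep A c J x)"
proof -
  have lincomb: "endo_rep A c J x (a *\<^sub>R u + b *\<^sub>R v) = a *\<^sub>R endo_rep A c J x u + b *\<^sub>R endo_rep A c J x v" for a b u v
    using chart_inv_in_topspace[OF assms]
    unfolding endo_rep_def Let_def coord_vec_lincomb[OF assms(1) chart_inv_in_dom[OF assms(2)]]
    by (simp add: J_lincomb coord_vec_tangent[OF assms(1) chart_inv_in_dom[OF assms(2)]])
      (simp add: tv_lincomb_def)
  show ?thesis
  proof (rule linearI)
    show "endo_rep A c J x (u + v) = endo_rep A c J x u + endo_rep A c J x v" for u v
      using lincomb[of 1 u 1 v] by simp
    show "endo_rep A c J x (r *\<^sub>R u) = r *\<^sub>R endo_rep A c J x u" for r u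
      using lincomb[of r u 0 u] by simp
  qed
qed

text \<open>The case distinction keeps the pullback normalised to \<open>0\<close> away from tangent vectors,
  where the values of \<open>J\<close> are arbitrary.\<close>

definition pullback_J :: "('a, 'e) form2 \<Rightarrow> ('a, 'e) form2" where
  "pullback_J \<omega> = (\<lambda>p X Y.
     if p \<in> topspace M \<and> X \<in> tangent_space A p \<and> Y \<in> tangent_space A p
     then \<omega> p (J p X) (J p Y) else 0)"

lemma pullback_J_eq:
  "p \<in> topspace M \<Longrightarrow> X \<in> tangent_space A p \<Longrightarrow> Y \<in> tangent_space A p \<Longrightarrow>
   pullback_J \<omega> p X Y = \<omega> p (J p X) (J p Y)"
  unfolding pullback_J_def by simp

lemma form2_rep_pullback_J:
  assumes "c \<in> A" "x \<in> chart_img c"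
  shows "form2_rep A c (pullback_J \<omega>) x u v
    = form2_rep A c \<omega> x (endo_rep A c J x u) (endo_rep A c J x v)"
proof -
  let ?p = "chart_inv c x"
  have "?p \<in> topspace M \<and> coord_vec A c ?p u \<in> tangent_space A ?p \<and> coord_vec A c ?p v \<in> tangent_space A ?p"
    using chart_inv_in_topspace[OF assms] coord_vec_tangent[OF assms(1) chart_inv_in_dom[OF assms(2)]]
    by blast
  then show ?thesis
    unfolding form2_rep_def pullback_J_def Let_def by (simp only: if_True simp_thms J_coord_vec[OF assms])
qed

text \<open>Smoothness is the substantial point: in a chart, the pullback evaluated on constant fields is
  \<open>\<omega>\<close> evaluated on the smooth fields obtained from them by \<open>J\<close>.\<close>

lemma pullback_J_forms2:
  assumes "\<omega> \<in> forms2 M A"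
  shows "pullback_J \<omega> \<in> forms2 M A"
proof -
  have smooth: "smooth_on (chart_img c) (\<lambda>x. form2_rep A c (pullback_J \<omega>) x u v)" if "c \<in> A" for c u v
  proof (rule smooth_on_cong[OF open_chart_img[OF that]])
    show "smooth_on (chart_img c) (\<lambda>x. form2_rep A c \<omega> x (endo_rep A c J x u) (endo_rep A c J x v))"
      by (rule smooth_form2_rep_fields[OF assms that smooth_endo_rep[OF that] smooth_endo_rep[OF that]])
  qed (simp only: form2_rep_pullback_J[OF that])
  show ?thesis
  proof (rule forms2I)
    fix p X Y
    assume "\<not> (p \<in> topspace M \<and> X \<in> tangent_space A p \<and> Y \<in> tangent_space A p)"
    then show "pullback_J \<omega> p X Y = 0"
      unfolding pullback_J_def by (simp only: if_False)
  next
    fix p X Y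
    assume T: "p \<in> topspace M" "X \<in> tangent_space A p" "Y \<in> tangent_space A p"
    show "pullback_J \<omega> p Y X = - pullback_J \<omega> p X Y"
      unfolding pullback_J_eq[OF T] pullback_J_eq[OF T(1,3,2)]
      by (rule forms2_skew[OF assms T(1) J_tangent[OF T(1,2)] J_tangent[OF T(1,3)]])
  next
    fix p X Y Z a b
    assume T: "p \<in> topspace M" "X \<in> tangent_space A p" "Y \<in> tangent_space A p" "Z \<in> tangent_space A p"
    show "pullback_J \<omega> p (tv_lincomb a X b Y) Z = a * pullback_J \<omega> p X Z + b * pullback_J \<omega> p Y Z"
      unfolding pullback_J_eq[OF T(1) tv_lincomb_tangent[OF T(1,2,3)] T(4)]
        pullback_J_eq[OF T(1,2,4)] pullback_J_eq[OF T(1,3,4)] J_lincomb[OF T(1,2,3)]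
      by (rule forms2_lincomb_left[OF assms T(1) J_tangent[OF T(1,2)] J_tangent[OF T(1,3)]
            J_tangent[OF T(1,4)]])
  qed (rule smooth)
qed

text \<open>Pulling back twice multiplies both arguments by \<open>-1\<close>, so the pullback by \<open>J\<close> is an
  involution of the 2-forms.\<close>

lemma pullback_J_J:
  assumes "\<omega> \<in> forms2 M A" "p \<in> topspace M" "X \<in> tangent_space A p" "Y \<in> tangent_space A p"
  shows "\<omega> p (J p (J p X)) (J p (J p Y)) = \<omega> p X Y"
proof -
  have left: "\<omega> p (tv_lincomb a X b X) Z = a * \<omega> p X Z + b * \<omega> p X Z"
    if "Z \<in> tangent_space A p" for a b Z
    using forms2_lincomb_left[OF assms(1,2,3,3) that] .
  have "\<omega> p (J p (J p X)) (J p (J p Y)) = - \<omega> p X (tv_lincomb (-1) Y 0 Y)"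
    using left[OF tv_lincomb_tangent[OF assms(2,4,4)]] assms by (simp add: J_J)
  then show ?thesis using forms2_lincomb_right[OF assms(1,2,4,4,3)] by simp
qed

lemma anti_invariant_part_exists:
  assumes "\<omega> \<in> forms2 M A"
  obtains \<alpha> where "is_anti_invariant_part M A J \<omega> \<alpha>"
proof
  let ?\<alpha> = "lincomb2 (1/2) \<omega> (-1/2) (pullback_J \<omega>)"
  let ?\<beta> = "lincomb2 (1/2) \<omega> (1/2) (pullback_J \<omega>)"
  note F = lincomb2_forms2[OF assms pullback_J_forms2[OF assms]]
  have J: "pullback_J \<omega> p (J p X) (J p Y) = \<omega> p X Y"
    if "p \<in> topspace M" "X \<in> tangent_space A p" "Y \<in> tangent_space A p" for p X Y
    using that by (simp add: pullback_J_eq J_tangent pullback_J_J[OF assms])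
  have "?\<alpha> p (J p X) (J p Y) = - ?\<alpha> p X Y" "?\<beta> p (J p X) (J p Y) = ?\<beta> p X Y"
    if "p \<in> topspace M" "X \<in> tangent_space A p" "Y \<in> tangent_space A p" for p X Y
    unfolding lincomb2_def J[OF that] pullback_J_eq[OF that] by simp_all
  then have "?\<alpha> \<in> anti_invariant_forms2 M A J" "?\<beta> \<in> invariant_forms2 M A J"
    unfolding anti_invariant_forms2_def invariant_forms2_def using F by blast+
  moreover have "\<omega> = (\<lambda>p X Y. ?\<beta> p X Y + ?\<alpha> p X Y)"
    by (simp add: lincomb2_def algebra_simps)
  ultimately show "is_anti_invariant_part M A J \<omega> ?\<alpha>"
    unfolding is_anti_invariant_part_def by blast
qed

section \<open>Positive forms\<close>

lemma J_positive_nondegenerate: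
  assumes "J_positive M A J \<omega>"
  shows "nondegenerate_form2 M A \<omega>"
  using assms J_tangent unfolding J_positive_def nondegenerate_form2_def
  by (metis less_irrefl)

lemma tamed_lincomb2:
  assumes "tamed_symplectic M A J \<sigma>" "tamed_symplectic M A J \<tau>"
    and "J_positive M A J (lincomb2 a \<sigma> b \<tau>)"
  shows "tamed_symplectic M A J (lincomb2 a \<sigma> b \<tau>)"
  using assms lincomb2_forms2 closed_lincomb2 J_positive_nondegenerate
  unfolding tamed_symplectic_def symplectic_form_def by blast

text \<open>This is the function \<open>X \<mapsto> \<omega>(X, JX)\<close> on the tangent bundle, read in a chart.\<close>

definition quad_rep :: "('a, 'e) chart \<Rightarrow> ('a, 'e) form2 \<Rightarrow> 'e \<Rightarrow> 'e \<Rightarrow> real" where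
  "quad_rep c \<omega> x u = form2_rep A c \<omega> x u (endo_rep A c J x u)"

lemma quad_rep_tangent:
  assumes "c \<in> A" "p \<in> chart_dom c" "X \<in> tangent_space A p"
  shows "quad_rep c \<omega> (chart_map c p) (X c) = \<omega> p X (J p X)"
proof -
  have p: "chart_inv c (chart_map c p) = p" "chart_map c p \<in> chart_img c"
    by (rule chart_inv_map[OF assms(1,2)], rule chart_map_in_img[OF assms(2)])
  show ?thesis
    using J_coord_vec[OF assms(1) p(2), of "X c"] tangent_eq_coord_vec[OF assms] p(1)
    unfolding quad_rep_def form2_rep_def Let_def by simp
qed

lemma quad_rep_bilinear:
  assumes "\<omega> \<in> forms2 M A" "c \<in> A" "x \<in> chart_img c"
  shows "bilinear (\<lambda>u v. form2_rep A c \<omega> x u (endo_rep A c J x v))"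
  using form2_rep_bilinear[OF assms]
    linear_compose[OF endo_rep_linear[OF assms(2,3)], unfolded comp_def]
  unfolding bilinear_def by blast

lemma quad_rep_scale:
  assumes "\<omega> \<in> forms2 M A" "c \<in> A" "x \<in> chart_img c"
  shows "quad_rep c \<omega> x (r *\<^sub>R u) = r\<^sup>2 * quad_rep c \<omega> x u"
  unfolding quad_rep_def
  using bilinear_lmul[OF quad_rep_bilinear[OF assms]] bilinear_rmul[OF quad_rep_bilinear[OF assms]]
  by (simp add: power2_eq_square)

lemma quad_rep_continuous:
  assumes "\<omega> \<in> forms2 M A" "c \<in> A"
  shows "continuous_on (chart_img c \<times> UNIV) (\<lambda>(x, u). quad_rep c \<omega> x u)"
proof -
  let ?B = "\<lambda>x i j. form2_rep A c \<omega> x i (endo_rep A c J x j)"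
  have B: "continuous_on (chart_img c) (\<lambda>x. ?B x i j)" for i j
    by (intro smooth_on_imp_continuous_on smooth_form2_rep_fields assms smooth_on_const
        smooth_endo_rep)
  have "continuous_on (chart_img c \<times> UNIV) (\<lambda>z::'e \<times> 'e. ?B (fst z) i j)" for i j
    by (rule continuous_on_compose2[OF B continuous_on_fst[OF continuous_on_id]]) auto
  then have "continuous_on (chart_img c \<times> UNIV) (\<lambda>z::'e \<times> 'e. \<Sum>i\<in>Basis. \<Sum>j\<in>Basis.
      (snd z \<bullet> i) * ((snd z \<bullet> j) * ?B (fst z) i j))"
    by (intro continuous_intros)
  then show ?thesis
    by (rule continuous_on_eq)
      (auto simp: quad_rep_def bilinear_expand[OF quad_rep_bilinear[OF assms], symmetric])
qed

lemma quad_rep_pos: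
  assumes "J_positive M A J \<omega>" "c \<in> A" "x \<in> chart_img c" "u \<noteq> 0"
  shows "quad_rep c \<omega> x u > 0"
proof -
  let ?p = "chart_inv c x"
  have p: "?p \<in> chart_dom c" "?p \<in> topspace M" "chart_map c ?p = x"
    by (rule chart_inv_in_dom[OF assms(3)], rule chart_inv_in_topspace[OF assms(2,3)],
        rule chart_map_inv[OF assms(3)])
  let ?X = "coord_vec A c ?p u"
  have X: "?X \<in> tangent_space A ?p" "?X c = u"
    by (rule coord_vec_tangent[OF assms(2) p(1)], rule coord_vec_self[OF assms(2) p(1)])
  then have "?X \<noteq> tv_zero" using assms(4) unfolding tv_zero_def by auto
  then have "\<omega> ?p ?X (J ?p ?X) > 0" using assms(1) p(2) X(1) unfolding J_positive_def by blast
  then show ?thesis using quad_rep_tangent[OF assms(2) p(1) X(1), of \<omega>] X(2) p(3) by simp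
qed

text \<open>Near a point, the quotient of the two quadratic functions is continuous on a compact ball
  times the unit sphere, hence bounded; it is homogeneous of degree \<open>0\<close> in the tangent vector, so
  the bound holds for all tangent vectors over the ball.\<close>

lemma positive_form_dominates_locally:
  assumes "\<omega>\<^sub>0 \<in> forms2 M A" "J_positive M A J \<omega>\<^sub>0" "\<omega> \<in> forms2 M A" "p \<in> topspace M"
  obtains U C where "openin M U" "p \<in> U"
    "\<And>q X. q \<in> U \<Longrightarrow> X \<in> tangent_space A q \<Longrightarrow> X \<noteq> tv_zero \<Longrightarrow>
       \<omega> q X (J q X) < C * \<omega>\<^sub>0 q X (J q X)"
proof -
  obtain c where c: "c \<in> A" "p \<in> chart_dom c" using obtain_chart assms(4) by blast
  obtain e where e: "e > 0" "cball (chart_map c p) e \<subseteq> chart_img c"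
    using open_contains_cball open_chart_img[OF c(1)] chart_map_in_img[OF c(2)] by blast
  let ?K = "cball (chart_map c p) e \<times> sphere (0::'e) 1"
  have cont: "continuous_on ?K (\<lambda>(x, u). quad_rep c \<sigma> x u)" if "\<sigma> \<in> forms2 M A" for \<sigma>
    using continuous_on_subset[OF quad_rep_continuous[OF that c(1)], of ?K] e(2) by auto
  have pos: "quad_rep c \<omega>\<^sub>0 x u > 0" if "(x, u) \<in> ?K" for x u
  proof (rule quad_rep_pos[OF assms(2) c(1)])
    show "x \<in> chart_img c" "u \<noteq> 0" using that e(2) by auto
  qed
  have "continuous_on ?K (\<lambda>z. (case z of (x, u) \<Rightarrow> quad_rep c \<omega> x u)
      / (case z of (x, u) \<Rightarrow> quad_rep c \<omega>\<^sub>0 x u))"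
    by (intro continuous_on_divide cont assms) (use pos in \<open>fastforce\<close>)
  then have "bounded ((\<lambda>z. (case z of (x, u) \<Rightarrow> quad_rep c \<omega> x u)
      / (case z of (x, u) \<Rightarrow> quad_rep c \<omega>\<^sub>0 x u)) ` ?K)"
    by (intro compact_imp_bounded compact_continuous_image compact_Times) auto
  then obtain b where b: "\<And>x u. (x, u) \<in> ?K \<Longrightarrow> \<bar>quad_rep c \<omega> x u / quad_rep c \<omega>\<^sub>0 x u\<bar> \<le> b"
    unfolding bounded_iff by (force simp: image_iff)
  show thesis
  proof
    show "openin M {q \<in> chart_dom c. chart_map c q \<in> ball (chart_map c p) e}"
      using openin_chart_preimage[OF c(1)] by blast
    show "p \<in> {q \<in> chart_dom c. chart_map c q \<in> ball (chart_map c p) e}"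
      using c e by simp
    fix q X
    assume q: "q \<in> {q \<in> chart_dom c. chart_map c q \<in> ball (chart_map c p) e}"
      and X: "X \<in> tangent_space A q" "X \<noteq> tv_zero"
    let ?x = "chart_map c q" and ?u = "X c /\<^sub>R norm (X c)"
    have qc: "q \<in> chart_dom c" "?x \<in> chart_img c" using q chart_map_in_img[of q c] by auto
    have "X c \<noteq> 0"
    proof
      assume "X c = 0"
      then have "X = coord_vec A c q (0 *\<^sub>R 0 + 0 *\<^sub>R 0)" using tangent_eq_coord_vec[OF c(1) qc(1) X(1)] by simp
      also have "\<dots> = tv_zero"
        unfolding coord_vec_lincomb[OF c(1) qc(1)] by (simp add: tv_lincomb_def tv_zero_def)
      finally show False using X(2) by blast
    qed
    then have K: "(?x, ?u) \<in> ?K" and n: "norm (X c) > 0" using q by (auto simp: mem_cball)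
    \<comment> \<open>The extra \<open>1\<close> makes the inequality strict.\<close>
    have "quad_rep c \<omega> ?x ?u / quad_rep c \<omega>\<^sub>0 ?x ?u < b + 1" using b[OF K] by linarith
    then have "quad_rep c \<omega> ?x ?u < (b + 1) * quad_rep c \<omega>\<^sub>0 ?x ?u"
      using pos[OF K] by (simp add: pos_divide_less_eq)
    then have "(norm (X c))\<^sup>2 * quad_rep c \<omega> ?x ?u < (norm (X c))\<^sup>2 * ((b + 1) * quad_rep c \<omega>\<^sub>0 ?x ?u)"
      using n by (simp only: mult_less_cancel_left_pos zero_less_power)
    moreover have "quad_rep c \<sigma> ?x (X c) = (norm (X c))\<^sup>2 * quad_rep c \<sigma> ?x ?u"
      if "\<sigma> \<in> forms2 M A" for \<sigma>
      using quad_rep_scale[OF that c(1) qc(2), of "norm (X c)" ?u] n by simp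
    ultimately have "quad_rep c \<omega> ?x (X c) < (b + 1) * quad_rep c \<omega>\<^sub>0 ?x (X c)"
      using assms(1,3) by (simp add: mult.left_commute)
    then show "\<omega> q X (J q X) < (b + 1) * \<omega>\<^sub>0 q X (J q X)"
      unfolding quad_rep_tangent[OF c(1) qc(1) X(1)] .
  qed
qed

text \<open>For the global bound it suffices to add up the absolute values of the local bounds over a
  finite cover: enlarging the constant preserves the inequality because \<open>\<omega>\<^sub>0\<close> is positive.\<close>

lemma positive_form_dominates:
  assumes "compact_space M" "\<omega>\<^sub>0 \<in> forms2 M A" "J_positive M A J \<omega>\<^sub>0" "\<omega> \<in> forms2 M A"
  obtains C where "\<And>p X. p \<in> topspace M \<Longrightarrow> X \<in> tangent_space A p \<Longrightarrow> X \<noteq> tv_zero \<Longrightarrow>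
       \<omega> p X (J p X) < C * \<omega>\<^sub>0 p X (J p X)"
proof -
  define dom where "dom U C \<longleftrightarrow> (\<forall>q\<in>U. \<forall>X\<in>tangent_space A q. X \<noteq> tv_zero \<longrightarrow>
       \<omega> q X (J q X) < C * \<omega>\<^sub>0 q X (J q X))" for U C
  let ?\<U> = "{U. openin M U \<and> (\<exists>C. dom U C)}"
  have "p \<in> \<Union>?\<U>" if p: "p \<in> topspace M" for p
  proof (rule positive_form_dominates_locally[OF assms(2-4) p])
    fix U C
    assume U: "openin M U" "p \<in> U"
      and "\<And>q X. q \<in> U \<Longrightarrow> X \<in> tangent_space A q \<Longrightarrow> X \<noteq> tv_zero \<Longrightarrow>
        \<omega> q X (J q X) < C * \<omega>\<^sub>0 q X (J q X)"
    then have "dom U C" unfolding dom_def by simp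
    then show "p \<in> \<Union>?\<U>" using U by blast
  qed
  then have "topspace M \<subseteq> \<Union>?\<U>" by blast
  then have "\<exists>\<F>. finite \<F> \<and> \<F> \<subseteq> ?\<U> \<and> topspace M \<subseteq> \<Union>\<F>"
    using compact_space_alt[THEN iffD1, OF assms(1), rule_format, of ?\<U>] by simp
  then obtain \<F> where F: "finite \<F>" "\<F> \<subseteq> ?\<U>" "topspace M \<subseteq> \<Union>\<F>" by auto
  then have "\<forall>U\<in>\<F>. \<exists>C. dom U C" by blast
  then obtain C where C: "\<And>U. U \<in> \<F> \<Longrightarrow> dom U (C U)" by metis
  show thesis
  proof
    fix p X
    assume p: "p \<in> topspace M" and X: "X \<in> tangent_space A p" "X \<noteq> tv_zero"
    obtain U where U: "U \<in> \<F>" "p \<in> U" using F(3) p by blast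
    have "C U \<le> (\<Sum>U\<in>\<F>. \<bar>C U\<bar>)"
      using order_trans[OF abs_ge_self member_le_sum[OF U(1), of "\<lambda>U. \<bar>C U\<bar>"]] F(1) by simp
    moreover have "\<omega>\<^sub>0 p X (J p X) > 0" using assms(3) p X unfolding J_positive_def by blast
    ultimately have "C U * \<omega>\<^sub>0 p X (J p X) \<le> (\<Sum>U\<in>\<F>. \<bar>C U\<bar>) * \<omega>\<^sub>0 p X (J p X)"
      by (rule mult_right_mono[OF _ less_imp_le])
    then show "\<omega> p X (J p X) < (\<Sum>U\<in>\<F>. \<bar>C U\<bar>) * \<omega>\<^sub>0 p X (J p X)"
      using C[OF U(1), unfolded dom_def, rule_format, OF U(2) X] by (rule less_le_trans[rotated])
  qed
qed

section \<open>Compatible forms and opposite anti-invariant parts\<close>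

lemma invariant_lincomb2:
  assumes "\<sigma> \<in> invariant_forms2 M A J" "\<tau> \<in> invariant_forms2 M A J"
  shows "lincomb2 a \<sigma> b \<tau> \<in> invariant_forms2 M A J"
  using assms lincomb2_forms2 unfolding invariant_forms2_def by (auto simp: lincomb2_def)

lemma uminus_anti_invariant:
  assumes "\<alpha> \<in> anti_invariant_forms2 M A J"
  shows "(\<lambda>p X Y. - \<alpha> p X Y) \<in> anti_invariant_forms2 M A J"
proof -
  have "lincomb2 (-1) \<alpha> 0 \<alpha> = (\<lambda>p X Y. - \<alpha> p X Y)" by (simp add: lincomb2_def)
  then have "(\<lambda>p X Y. - \<alpha> p X Y) \<in> forms2 M A"
    using lincomb2_forms2[of \<alpha> \<alpha> "-1" 0] assms unfolding anti_invariant_forms2_def by simp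
  then show ?thesis using assms unfolding anti_invariant_forms2_def by auto
qed

text \<open>The wanted form is \<open>C \<omega>\<^sub>0 - \<omega>\<close>: subtracting \<open>\<omega>\<close> reverses the anti-invariant part, and a
  large multiple of the compatible form restores positivity without contributing to that part.\<close>

lemma opposite_part_if_compatible:
  assumes "compact_space M" "compatible_symplectic M A J \<omega>\<^sub>0"
    and "tamed_symplectic M A J \<omega>" "is_anti_invariant_part M A J \<omega> \<alpha>"
  shows "\<exists>\<omega>'. tamed_symplectic M A J \<omega>' \<and>
    is_anti_invariant_part M A J \<omega>' (\<lambda>p X Y. - \<alpha> p X Y)"
proof -
  have \<omega>0: "tamed_symplectic M A J \<omega>\<^sub>0" "\<omega>\<^sub>0 \<in> invariant_forms2 M A J" "\<omega>\<^sub>0 \<in> forms2 M A"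
      "J_positive M A J \<omega>\<^sub>0"
    using assms(2) unfolding compatible_symplectic_def tamed_symplectic_def symplectic_form_def by auto
  have \<omega>: "\<omega> \<in> forms2 M A"
    using assms(3) unfolding tamed_symplectic_def symplectic_form_def by auto
  obtain C where C: "\<And>p X. p \<in> topspace M \<Longrightarrow> X \<in> tangent_space A p \<Longrightarrow> X \<noteq> tv_zero \<Longrightarrow>
       \<omega> p X (J p X) < C * \<omega>\<^sub>0 p X (J p X)"
    using positive_form_dominates[OF assms(1) \<omega>0(3,4) \<omega>] by blast
  let ?\<omega>' = "lincomb2 C \<omega>\<^sub>0 (-1) \<omega>"
  have "J_positive M A J ?\<omega>'"
    unfolding J_positive_def using C by (simp add: lincomb2_def)
  then have "tamed_symplectic M A J ?\<omega>'" using tamed_lincomb2 \<omega>0(1) assms(3) by blast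
  moreover
  obtain \<beta> where \<beta>: "\<beta> \<in> invariant_forms2 M A J" "\<omega> = (\<lambda>p X Y. \<beta> p X Y + \<alpha> p X Y)"
    and \<alpha>: "\<alpha> \<in> anti_invariant_forms2 M A J"
    using assms(4) unfolding is_anti_invariant_part_def by blast
  have "?\<omega>' = (\<lambda>p X Y. lincomb2 C \<omega>\<^sub>0 (-1) \<beta> p X Y + - \<alpha> p X Y)"
    unfolding \<beta>(2) by (simp add: lincomb2_def algebra_simps)
  then have "is_anti_invariant_part M A J ?\<omega>' (\<lambda>p X Y. - \<alpha> p X Y)"
    unfolding is_anti_invariant_part_def
    using invariant_lincomb2[OF \<omega>0(2) \<beta>(1)] uminus_anti_invariant[OF \<alpha>] by blast
  ultimately show ?thesis by blast
qed

text \<open>The opposite anti-invariant parts cancel in the sum, which is therefore invariant, and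
  positivity is preserved by sums.\<close>

lemma compatible_if_opposite_parts:
  assumes "tamed_symplectic M A J \<omega>" "is_anti_invariant_part M A J \<omega> \<alpha>"
    and "tamed_symplectic M A J \<omega>'" "is_anti_invariant_part M A J \<omega>' (\<lambda>p X Y. - \<alpha> p X Y)"
  shows "compatible_symplectic M A J (lincomb2 1 \<omega> 1 \<omega>')"
proof -
  obtain \<beta> where \<beta>: "\<beta> \<in> invariant_forms2 M A J" "\<omega> = (\<lambda>p X Y. \<beta> p X Y + \<alpha> p X Y)"
    using assms(2) unfolding is_anti_invariant_part_def by blast
  obtain \<beta>' where \<beta>': "\<beta>' \<in> invariant_forms2 M A J" "\<omega>' = (\<lambda>p X Y. \<beta>' p X Y + - \<alpha> p X Y)"
    using assms(4) unfolding is_anti_invariant_part_def by blast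
  have "lincomb2 1 \<omega> 1 \<omega>' = lincomb2 1 \<beta> 1 \<beta>'"
    unfolding \<beta>(2) \<beta>'(2) by (simp add: lincomb2_def)
  then have inv: "lincomb2 1 \<omega> 1 \<omega>' \<in> invariant_forms2 M A J"
    using invariant_lincomb2[OF \<beta>(1) \<beta>'(1)] by simp
  have "J_positive M A J (lincomb2 1 \<omega> 1 \<omega>')"
    using assms(1,3) unfolding tamed_symplectic_def J_positive_def
    by (simp add: lincomb2_def add_pos_pos)
  then show ?thesis
    using tamed_lincomb2[OF assms(1,3)] inv
    unfolding compatible_symplectic_def tamed_symplectic_def by blast
qed

end

theorem theorem3p6:
  fixes M :: "'a topology"
    and A :: "('a, 'e::euclidean_space) chart set"
    and J :: "('a, 'e) endo"
    and n :: nat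
  assumes "smooth_manifold M A"
    and "compact_space M"
    and "DIM('e) = 2 * n"
    and "almost_complex_structure M A J"
    and "\<exists>\<omega>. tamed_symplectic M A J \<omega>"
  shows "(\<exists>\<omega>. compatible_symplectic M A J \<omega>) \<longleftrightarrow>
    (\<forall>\<alpha>\<in>anti_invariant_forms2 M A J.
       (\<exists>\<omega>. tamed_symplectic M A J \<omega> \<and> is_anti_invariant_part M A J \<omega> \<alpha>) \<longrightarrow>
       (\<exists>\<omega>'. tamed_symplectic M A J \<omega>' \<and>
             is_anti_invariant_part M A J \<omega>' (\<lambda>p X Y. - \<alpha> p X Y)))"
proof -
  interpret almost_complex_atlas M A J
    using assms(1,4) by unfold_locales (auto simp: smooth_manifold_def)
  show ?thesis
  proof
    assume "\<exists>\<omega>. compatible_symplectic M A J \<omega>"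
    then show "\<forall>\<alpha>\<in>anti_invariant_forms2 M A J.
       (\<exists>\<omega>. tamed_symplectic M A J \<omega> \<and> is_anti_invariant_part M A J \<omega> \<alpha>) \<longrightarrow>
       (\<exists>\<omega>'. tamed_symplectic M A J \<omega>' \<and>
             is_anti_invariant_part M A J \<omega>' (\<lambda>p X Y. - \<alpha> p X Y))"
      using opposite_part_if_compatible[OF assms(2)] by blast
  next
    assume opp: "\<forall>\<alpha>\<in>anti_invariant_forms2 M A J.
       (\<exists>\<omega>. tamed_symplectic M A J \<omega> \<and> is_anti_invariant_part M A J \<omega> \<alpha>) \<longrightarrow>
       (\<exists>\<omega>'. tamed_symplectic M A J \<omega>' \<and>
             is_anti_invariant_part M A J \<omega>' (\<lambda>p X Y. - \<alpha> p X Y))"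
    obtain \<omega> where \<omega>: "tamed_symplectic M A J \<omega>" using assms(5) by blast
    obtain \<alpha> where \<alpha>: "is_anti_invariant_part M A J \<omega> \<alpha>"
      using anti_invariant_part_exists \<omega> unfolding tamed_symplectic_def symplectic_form_def by blast
    then have "\<alpha> \<in> anti_invariant_forms2 M A J" unfolding is_anti_invariant_part_def by blast
    then obtain \<omega>' where "tamed_symplectic M A J \<omega>'"
        "is_anti_invariant_part M A J \<omega>' (\<lambda>p X Y. - \<alpha> p X Y)"
      using opp \<omega> \<alpha> by blast
    then show "\<exists>\<omega>. compatible_symplectic M A J \<omega>"
      using compatible_if_opposite_parts[OF \<omega> \<alpha>] by blast
  qed
qed

end
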